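(* The four-dimensional real Lie algebra $\mathfrak{r}_2'$, equipped with its bi-invariant complex structure $J$, admits a unique compatible metric up to isometry and scaling. That is, compatible inner products exist, and for any two positive-definite inner products $\langle\cdot,\cdot\rangle$ and $\langle\cdot,\cdot\rangle'$ on $\mathfrak{r}_2'$ compatible with $J$ there exist a real number $c>0$ and a Lie algebra automorphism $\varphi$ of $\mathfrak{r}_2'$ such that $\langle\varphi X,\varphi Y\rangle'=c\,\langle X,Y\rangle$ for all $X,Y\in\mathfrak{r}_2'$.
   Context: A complex structure $J$ on a real Lie algebra $\mathfrak{g}$ (so $J^2=-\operatorname{Id}$) is bi-invariant if $[JX,Y]=J[X,Y]$ for all $X,Y\in\mathfrak{g}$. A positive-definite inner product is compatible with $J$ if $J$ is an isometry for it, i.e. $\langle JX,JY\rangle=\langle X,Y\rangle$. Two metric Lie algebras are regarded as isometric when there is a Lie algebra isomorphism between them that is also a linear isometry. The pair $(\mathfrak{r}_2',J)$ is, up to holomorphic isomorphism (Lie algebra isomorphism intertwining the complex structures), $\mathbb{R}^4$ with basis $e_1,\dots,e_4$, nonzero brackets (up to antisymmetry) $[e_1,e_2]=e_2$, $[e_1,e_4]=e_4$, $[e_2,e_3]=-e_4$, $[e_3,e_4]=-e_2$, and $J e_1=e_3$, $Je_2=e_4$, $Je_3=-e_1$, $Je_4=-e_2$. *)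

theory Defs
  imports "HOL-Analysis.Analysis"
begin

definition lie_bracket :: "('a::real_vector \<Rightarrow> 'a \<Rightarrow> 'a) \<Rightarrow> bool" where
  "lie_bracket br \<longleftrightarrow>
     bilinear br \<and> (\<forall>x. br x x = 0) \<and>
     (\<forall>x y z. br x (br y z) + br y (br z x) + br z (br x y) = 0)"

definition lie_automorphism :: "('a::real_vector \<Rightarrow> 'a \<Rightarrow> 'a) \<Rightarrow> ('a \<Rightarrow> 'a) \<Rightarrow> bool" where
  "lie_automorphism br f \<longleftrightarrow>
     linear f \<and> bij f \<and> (\<forall>x y. f (br x y) = br (f x) (f y))"

definition bi_invariant_complex_structure ::
    "('a::real_vector \<Rightarrow> 'a \<Rightarrow> 'a) \<Rightarrow> ('a \<Rightarrow> 'a) \<Rightarrow> bool" where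
  "bi_invariant_complex_structure br J \<longleftrightarrow>
     linear J \<and> (\<forall>x. J (J x) = - x) \<and> (\<forall>x y. br (J x) y = J (br x y))"

definition inner_product :: "('a::real_vector \<Rightarrow> 'a \<Rightarrow> real) \<Rightarrow> bool" where
  "inner_product g \<longleftrightarrow>
     bilinear g \<and> (\<forall>x y. g x y = g y x) \<and> (\<forall>x. x \<noteq> 0 \<longrightarrow> g x x > 0)"

definition compatible_metric ::
    "('a::real_vector \<Rightarrow> 'a) \<Rightarrow> ('a \<Rightarrow> 'a \<Rightarrow> real) \<Rightarrow> bool" where
  "compatible_metric J g \<longleftrightarrow> inner_product g \<and> (\<forall>x y. g (J x) (J y) = g x y)"

(* The basis vector e_i is axis i 1, for i = 1, 2, 3, 4. Note that 4 = 0 in the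
   index type 4, which is harmless: the four indices are distinct. The coordinate
   formulas are the bilinear (resp. linear) extensions of the values on the basis
   given by r2'_bracket_basis and r2'_J_basis below. *)

definition r2'_bracket :: "real^4 \<Rightarrow> real^4 \<Rightarrow> real^4" where
  "r2'_bracket x y =
     (x$1 * y$2 - x$2 * y$1 - (x$3 * y$4 - x$4 * y$3)) *\<^sub>R axis 2 1 +
     (x$1 * y$4 - x$4 * y$1 - (x$2 * y$3 - x$3 * y$2)) *\<^sub>R axis 4 1"

definition r2'_J :: "real^4 \<Rightarrow> real^4" where
  "r2'_J x = x$1 *\<^sub>R axis 3 1 + x$2 *\<^sub>R axis 4 1 - x$3 *\<^sub>R axis 1 1 - x$4 *\<^sub>R axis 2 1"

lemma r2'_bracket_basis:
  "r2'_bracket (axis 1 1) (axis 2 1) = axis 2 1"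
  "r2'_bracket (axis 1 1) (axis 3 1) = 0"
  "r2'_bracket (axis 1 1) (axis 4 1) = axis 4 1"
  "r2'_bracket (axis 2 1) (axis 3 1) = - axis 4 1"
  "r2'_bracket (axis 2 1) (axis 4 1) = 0"
  "r2'_bracket (axis 3 1) (axis 4 1) = - axis 2 1"
  by (simp_all add: r2'_bracket_def axis_def)

lemma r2'_J_basis:
  "r2'_J (axis 1 1) = axis 3 1"
  "r2'_J (axis 2 1) = axis 4 1"
  "r2'_J (axis 3 1) = - axis 1 1"
  "r2'_J (axis 4 1) = - axis 2 1"
  by (simp_all add: r2'_J_def axis_def)

lemma lie_bracket_r2': "lie_bracket r2'_bracket"
  unfolding lie_bracket_def bilinear_def
  by (auto intro!: linearI simp: r2'_bracket_def vec_eq_iff forall_4 axis_def algebra_simps)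

lemma bi_invariant_complex_structure_r2':
  "bi_invariant_complex_structure r2'_bracket r2'_J"
  unfolding bi_invariant_complex_structure_def
  by (auto intro!: linearI
      simp: r2'_bracket_def r2'_J_def vec_eq_iff forall_4 axis_def algebra_simps)

end

(* Identify R^4 with C^2 by z = x1 + i x3, w = x2 + i x4; the bracket becomes
   [(z,w),(z',w')] = (0, z w' - w z') and J multiplication by i. Every map
   (z,w) |-> (z, alpha w + beta z) with alpha a nonzero real and beta complex is an automorphism
   commuting with J. Given a compatible g, choose beta so that the image u of e1 is g-orthogonal
   to the complex line spanned by e2, then alpha so that the image of e2 has the same length as u:
   this carries g to a multiple of the standard inner product. *)

theory Submission
  imports Defs
begin

lemma lie_automorphism_compose:
  assumes "lie_automorphism br f" "lie_automorphism br h"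
  shows "lie_automorphism br (f \<circ> h)"
  using assms unfolding lie_automorphism_def
  by (auto intro: linear_compose bij_comp)

lemma lie_automorphism_inv:
  fixes br :: "'a::real_vector \<Rightarrow> 'a \<Rightarrow> 'a"
  assumes "lie_automorphism br f"
  shows "lie_automorphism br (inv f)"
proof -
  have f: "linear f" "bij f" "\<And>x y. f (br x y) = br (f x) (f y)"
    using assms by (auto simp: lie_automorphism_def)
  have surj: "f (inv f x) = x" and inj: "inv f (f x) = x" for x
    using f(2) by (auto simp: bij_def surj_f_inv_f)
  have "linear (inv f)"
    by (rule linearI) (metis surj inj linear_add[OF f(1)] linear_cmul[OF f(1)])+
  moreover have "inv f (br x y) = br (inv f x) (inv f y)" for x y
    by (metis surj inj f(3))
  ultimately show ?thesis
    using f(2) by (simp add: lie_automorphism_def bij_imp_bij_inv)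
qed

text \<open>The pullback stays positive definite by injectivity of \<open>f\<close> and stays
  \<open>J\<close>-invariant because \<open>f\<close> commutes with \<open>J\<close>.\<close>

lemma compatible_metric_compose:
  assumes "compatible_metric J g" "linear f" "inj f" "\<And>x. f (J x) = J (f x)"
  shows "compatible_metric J (\<lambda>x y. g (f x) (f y))"
proof -
  have g: "bilinear g" "\<And>x y. g x y = g y x" "\<And>x. x \<noteq> 0 \<Longrightarrow> g x x > 0"
    "\<And>x y. g (J x) (J y) = g x y"
    using assms(1) by (auto simp: compatible_metric_def inner_product_def)
  have "bilinear (\<lambda>x y. g (f x) (f y))"
    unfolding bilinear_def
    by (auto intro!: linearI simp: linear_add[OF assms(2)] linear_cmul[OF assms(2)]
        bilinear_ladd[OF g(1)] bilinear_radd[OF g(1)] bilinear_lmul[OF g(1)] bilinear_rmul[OF g(1)])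
  moreover have "f x \<noteq> 0" if "x \<noteq> 0" for x
    using that assms(2,3) linear_injective_0 by blast
  ultimately show ?thesis
    using g assms(4) by (auto simp: compatible_metric_def inner_product_def)
qed

lemma compatible_metric_r2'_inner: "compatible_metric r2'_J (\<bullet>)"
proof -
  have "r2'_J x \<bullet> r2'_J y = x \<bullet> y" for x y
    by (simp add: inner_vec_def sum_4 r2'_J_def axis_def)
  then show ?thesis
    by (simp add: compatible_metric_def inner_product_def bilinear_conv_bounded_bilinear
        bounded_bilinear_inner inner_commute)
qed

text \<open>A compatible metric is the real part of a Hermitian form on C^2, so its values on the
  pairs (e1,e1), (e2,e2), (e1,e2), (e1,e4) fix all the others.\<close>

lemma compatible_metric_r2'_eq_inner:
  assumes h: "compatible_metric r2'_J h"
    and h11: "h (axis 1 1) (axis 1 1) = c" and h22: "h (axis 2 1) (axis 2 1) = c"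
    and h12: "h (axis 1 1) (axis 2 1) = 0" and h14: "h (axis 1 1) (axis 4 1) = 0"
  shows "h x y = c * (x \<bullet> y)"
proof -
  have bil: "bilinear h" and sym: "h x y = h y x" and J: "h (r2'_J x) (r2'_J y) = h x y" for x y
    using h by (auto simp: compatible_metric_def inner_product_def)
  note J' = J[of "axis i 1" "axis j 1" for i j, symmetric]
  \<comment> \<open>\<open>h X (J X) = h (J X) (- X) = - h X (J X)\<close>, so every vector is
    orthogonal to its image under \<open>J\<close>.\<close>
  have h13: "h (axis 1 1) (axis 3 1) = 0" and h24: "h (axis 2 1) (axis 4 1) = 0"
    using J'[of 1 3] J'[of 2 4] sym[of "axis 3 1" "axis 1 1"] sym[of "axis 4 1" "axis 2 1"]
    by (simp_all add: r2'_J_basis bilinear_rneg[OF bil])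
  have h33: "h (axis 3 1) (axis 3 1) = c" and h44: "h (axis 4 1) (axis 4 1) = c"
    and h34: "h (axis 3 1) (axis 4 1) = 0" and h32: "h (axis 3 1) (axis 2 1) = 0"
    using J'[of 1 1] J'[of 2 2] J'[of 1 2] J'[of 1 4] h11 h22 h12 h14
    by (simp_all add: r2'_J_basis bilinear_rneg[OF bil])
  note h_basis = h11 h22 h33 h44 h12 h13 h14 h32 h24 h34
  have "bilinear (\<lambda>x y. c * (x \<bullet> y) :: real)" for c :: real
    unfolding bilinear_def by (auto intro!: linearI simp: algebra_simps)
  \<comment> \<open>Of the sixteen basis pairs, ten are in \<open>h_basis\<close>; the instances of
    \<open>sym\<close> flip the other six into these.\<close>
  moreover have "h (axis i 1) (axis j 1) = c * (axis i 1 \<bullet> (axis j 1 :: real^4))" for i j :: 4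
    using exhaust_4[of i] exhaust_4[of j]
    by (auto simp: inner_axis_axis h_basis
        sym[of "axis 2 1" "axis 1 1"] sym[of "axis 3 1" "axis 1 1"] sym[of "axis 4 1" "axis 1 1"]
        sym[of "axis 2 1" "axis 3 1"] sym[of "axis 4 1" "axis 2 1"] sym[of "axis 4 1" "axis 3 1"])
  ultimately show ?thesis
    using bilinear_eq_stdbasis[OF bil, of "\<lambda>x y. c * (x \<bullet> y)"]
    by (force simp: Basis_vec_def)
qed

text \<open>In the complex coordinates, alpha is \<open>a\<close> and beta is p + iq.\<close>

definition r2'_aut :: "real \<Rightarrow> real \<Rightarrow> real \<Rightarrow> real^4 \<Rightarrow> real^4" where
  "r2'_aut a p q x =
     x$1 *\<^sub>R axis 1 1 + (a * x$2 + p * x$1 - q * x$3) *\<^sub>R axis 2 1 +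
     x$3 *\<^sub>R axis 3 1 + (a * x$4 + q * x$1 + p * x$3) *\<^sub>R axis 4 1"

lemma linear_r2'_aut: "linear (r2'_aut a p q)"
  by (rule linearI) (auto simp: r2'_aut_def vec_eq_iff forall_4 axis_def algebra_simps)

lemma r2'_aut_J: "r2'_aut a p q (r2'_J x) = r2'_J (r2'_aut a p q x)"
  by (auto simp: r2'_aut_def r2'_J_def vec_eq_iff forall_4 axis_def)

lemma inj_r2'_aut: "a \<noteq> 0 \<Longrightarrow> inj (r2'_aut a p q)"
  by (auto simp: linear_injective_0[OF linear_r2'_aut] r2'_aut_def vec_eq_iff forall_4 axis_def)

text \<open>The beta terms cancel in z (alpha w' + beta z') - (alpha w + beta z) z' = alpha (z w' -
  w z'), and a bracket has zero z-component, so the map just scales it by alpha.\<close>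

lemma lie_automorphism_r2'_aut:
  assumes "a \<noteq> 0"
  shows "lie_automorphism r2'_bracket (r2'_aut a p q)"
proof -
  have "bij (r2'_aut a p q)"
    using inj_r2'_aut[OF assms] linear_injective_imp_surjective[OF linear_r2'_aut]
    by (auto simp: bij_def)
  moreover have "r2'_aut a p q (r2'_bracket x y) =
      r2'_bracket (r2'_aut a p q x) (r2'_aut a p q y)" for x y
    by (auto simp: r2'_aut_def r2'_bracket_def vec_eq_iff forall_4 axis_def algebra_simps)
  ultimately show ?thesis
    by (simp add: lie_automorphism_def linear_r2'_aut)
qed

lemma r2'_aut_basis:
  "r2'_aut a p q (axis 1 1) = axis 1 1 + p *\<^sub>R axis 2 1 + q *\<^sub>R axis 4 1"
  "r2'_aut a p q (axis 2 1) = a *\<^sub>R axis 2 1"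
  "r2'_aut a p q (axis 4 1) = a *\<^sub>R axis 4 1"
  by (simp_all add: r2'_aut_def vec_eq_iff forall_4 axis_def)

text \<open>Serves to compare any two compatible metrics by way of the standard one.\<close>

lemma compatible_metric_r2'_standard_form:
  assumes g: "compatible_metric r2'_J g"
  obtains c f where "c > 0" "lie_automorphism r2'_bracket f"
    "\<And>x y. g (f x) (f y) = c * (x \<bullet> y)"
proof -
  have bil: "bilinear g" and sym: "\<And>x y. g x y = g y x" and pos: "\<And>x. x \<noteq> 0 \<Longrightarrow> g x x > 0"
    and J: "\<And>x y. g (r2'_J x) (r2'_J y) = g x y"
    using g by (auto simp: compatible_metric_def inner_product_def)
  note bil_simps = bilinear_ladd[OF bil] bilinear_radd[OF bil]
    bilinear_lmul[OF bil] bilinear_rmul[OF bil]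
  define D where "D = g (axis 2 1) (axis 2 1)"
  have g44: "g (axis 4 1) (axis 4 1) = D"
    using J[of "axis 2 1" "axis 2 1"] by (simp add: r2'_J_basis D_def)
  have g24: "g (axis 2 1) (axis 4 1) = 0"
    using J[of "axis 2 1" "axis 4 1"] sym[of "axis 4 1" "axis 2 1"]
    by (simp add: r2'_J_basis bilinear_rneg[OF bil])
  have g42: "g (axis 4 1) (axis 2 1) = 0"
    using g24 sym by metis
  have D: "D > 0"
    by (auto simp: D_def intro!: pos)
  \<comment> \<open>Gram-Schmidt: e2 and e4 are orthogonal of squared length \<open>D\<close>, so
    \<open>u\<close> below is e1 minus its projection to their span.\<close>
  define p where "p = - g (axis 1 1) (axis 2 1) / D"
  define q where "q = - g (axis 1 1) (axis 4 1) / D"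
  define u where "u = axis 1 1 + p *\<^sub>R axis 2 1 + q *\<^sub>R (axis 4 1 :: real^4)"
  \<comment> \<open>Chosen so that \<open>a\<close> times e2 has the same squared length as
    \<open>u\<close>.\<close>
  define a where "a = sqrt (g u u / D)"
  have "u $ 1 = 1"
    by (simp add: u_def axis_def)
  then have "g u u > 0"
    by (intro pos) auto
  with D have a: "a \<noteq> 0" and "a * a = g u u / D"
    by (simp_all add: a_def)
  with D have aD: "a * (a * D) = g u u"
    by (simp add: field_simps)
  have "p * D = - g (axis 1 1) (axis 2 1)" "q * D = - g (axis 1 1) (axis 4 1)"
    using D by (simp_all add: p_def q_def)
  then have u2: "g u (axis 2 1) = 0" and u4: "g u (axis 4 1) = 0"
    by (simp_all add: u_def bil_simps g24 g42 g44 D_def[symmetric])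
  have f1: "r2'_aut a p q (axis 1 1) = u"
    by (simp only: r2'_aut_basis u_def)
  \<comment> \<open>The pulled-back metric is compatible, and its four determining values are
    \<open>g u u\<close>, \<open>a * (a * D)\<close>, \<open>a * g u (axis 2 1)\<close> and
    \<open>a * g u (axis 4 1)\<close>.\<close>
  have "g (r2'_aut a p q x) (r2'_aut a p q y) = g u u * (x \<bullet> y)" for x y
    by (rule compatible_metric_r2'_eq_inner[OF compatible_metric_compose[where f = "r2'_aut a p q",
            OF g linear_r2'_aut inj_r2'_aut[OF a] r2'_aut_J]])
      (simp_all add: f1 r2'_aut_basis(2,3) bilinear_lmul[OF bil] bilinear_rmul[OF bil]
        u2 u4 aD D_def[symmetric])
  with that \<open>g u u > 0\<close> lie_automorphism_r2'_aut[OF a] show thesis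
    by blast
qed

theorem theorem4p1:
  shows "(\<exists>g. compatible_metric r2'_J g) \<and>
    (\<forall>g g'. compatible_metric r2'_J g \<and> compatible_metric r2'_J g' \<longrightarrow>
      (\<exists>c \<phi>. c > 0 \<and> lie_automorphism r2'_bracket \<phi> \<and>
        (\<forall>x y. g' (\<phi> x) (\<phi> y) = c * g x y)))"
proof (intro conjI allI impI; (elim conjE)?)
  show "\<exists>g. compatible_metric r2'_J g"
    using compatible_metric_r2'_inner by blast
next
  fix g g'
  assume "compatible_metric r2'_J g" "compatible_metric r2'_J g'"
  obtain c f where f: "c > 0" "lie_automorphism r2'_bracket f"
    "\<And>x y. g (f x) (f y) = c * (x \<bullet> y)"
    using compatible_metric_r2'_standard_form[OF \<open>compatible_metric r2'_J g\<close>] by blast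
  obtain c' f' where f': "c' > 0" "lie_automorphism r2'_bracket f'"
    "\<And>x y. g' (f' x) (f' y) = c' * (x \<bullet> y)"
    using compatible_metric_r2'_standard_form[OF \<open>compatible_metric r2'_J g'\<close>] by blast
  have "f (inv f x) = x" for x
    using f(2) by (simp add: lie_automorphism_def bij_def surj_f_inv_f)
  then have "g x y = c * (inv f x \<bullet> inv f y)" for x y
    using f(3)[of "inv f x" "inv f y"] by simp
  \<comment> \<open>\<open>inv f\<close> carries \<open>g\<close> to the standard metric up to the
    factor \<open>c\<close>, and \<open>f'\<close> carries that on to \<open>g'\<close> up to
    \<open>c'\<close>.\<close>
  then have "g' ((f' \<circ> inv f) x) ((f' \<circ> inv f) y) = (c' / c) * g x y" for x y
    using f(1) f'(3) by simp
  then show "\<exists>c \<phi>. c > 0 \<and> lie_automorphism r2'_bracket \<phi> \<and>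
      (\<forall>x y. g' (\<phi> x) (\<phi> y) = c * g x y)"
    using f(1) f'(1) lie_automorphism_compose[OF f'(2) lie_automorphism_inv[OF f(2)]]
    by (meson divide_pos_pos)
qed

end
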